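(* There is an absolute constant $c>0$ such that the following holds for the online mixed covering and packing problem. Let $l\ge2$, $d\ge2$ and let $\vec c_1,\dots,\vec c_l\in\mathbb{R}_+^n$ be vectors each having at most $d$ non-zero coordinates. Then there is a $(c\log l\,\log d)$-competitive online algorithm for online convex covering with cost function $\max_{k\in[l]}\langle\vec c_k,\vec x\rangle$.
   Context: Online mixed covering and packing problem: the vectors $\vec c_1,\dots,\vec c_l$ are known in advance. The algorithm maintains $\vec x\in\mathbb{R}_+^n$ whose coordinates may only increase over time. In round $j=1,\dots,m$ a nonzero vector $\vec a_j\in\mathbb{R}_+^n$ arrives (possibly chosen adversarially depending on the algorithm's past responses), and the algorithm must immediately, without knowledge of future vectors (or of $m$), increase coordinates of $\vec x$ so that $\langle\vec a_j,\vec x\rangle\ge 1$. The cost of $\vec x$ is $\max_{k\in[l]}\langle\vec c_k,\vec x\rangle$. Let $C^{\mathrm{opt}}$ be the minimum cost over all $\vec x\in\mathbb{R}_+^n$ with $\langle\vec a_j,\vec x\rangle\ge1$ for all $j\in[m]$. The algorithm is $\alpha$-competitive if for every instance its final vector has cost at most $\alpha\cdot C^{\mathrm{opt}}$. *)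

theory Defs
  imports Complex_Main "Jordan_Normal_Form.Matrix"
begin

definition nonneg_vecs :: "nat \<Rightarrow> real vec set" where
  "nonneg_vecs n = {x \<in> carrier_vec n. 0\<^sub>v n \<le> x}"

text \<open>An instance is the list of the covering vectors in their order of arrival.\<close>

definition covering_instance :: "nat \<Rightarrow> real vec list \<Rightarrow> bool" where
  "covering_instance n rs \<longleftrightarrow> set rs \<subseteq> nonneg_vecs n - {0\<^sub>v n}"

definition feasible :: "nat \<Rightarrow> real vec list \<Rightarrow> real vec set" where
  "feasible n rs = {x \<in> nonneg_vecs n. \<forall>a \<in> set rs. a \<bullet> x \<ge> 1}"

text \<open>The infimum below is over a nonempty set, bounded below for every nonnegative \<open>cost\<close>;
  for a maximum of finitely many nonnegative linear forms it is attained (linear programming),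
  so there it is the minimum cost.\<close>

definition opt_cost :: "nat \<Rightarrow> (real vec \<Rightarrow> real) \<Rightarrow> real vec list \<Rightarrow> real" where
  "opt_cost n cost rs = Inf (cost ` feasible n rs)"

text \<open>A (deterministic) online algorithm is a function of the list of vectors seen so far:
  \<open>A []\<close> is its initial vector and \<open>A (rs @ [a])\<close> its vector after it has answered \<open>a\<close>.
  Since its earlier responses are determined by this list, an adversary that
  adapts to them is covered by quantifying over all lists.\<close>

definition online_covering_algorithm :: "nat \<Rightarrow> (real vec list \<Rightarrow> real vec) \<Rightarrow> bool" where
  "online_covering_algorithm n A \<longleftrightarrow>
     A [] \<in> nonneg_vecs n \<and>
     (\<forall>rs a. covering_instance n (rs @ [a]) \<longrightarrow>
        A (rs @ [a]) \<in> nonneg_vecs n \<and>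
        A rs \<le> A (rs @ [a]) \<and>
        a \<bullet> A (rs @ [a]) \<ge> 1)"

definition competitive ::
  "nat \<Rightarrow> (real vec \<Rightarrow> real) \<Rightarrow> real \<Rightarrow> (real vec list \<Rightarrow> real vec) \<Rightarrow> bool" where
  "competitive n cost \<alpha> A \<longleftrightarrow>
     (\<forall>rs. covering_instance n rs \<longrightarrow> cost (A rs) \<le> \<alpha> * opt_cost n cost rs)"

definition max_cost :: "nat \<Rightarrow> (nat \<Rightarrow> real vec) \<Rightarrow> real vec \<Rightarrow> real" where
  "max_cost l cs x = (MAX k\<in>{1..l}. cs k \<bullet> x)"

definition num_nonzero :: "real vec \<Rightarrow> nat" where
  "num_nonzero v = card {i. i < dim_vec v \<and> v $ i \<noteq> 0}"

end

(* Suppose first that the optimum is known to be at most 1, and call a coordinate active while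
   x_i < 2 / M_i, where M_i = max_k c_ki.  An optimal y has y_i <= 1 / M_i, so the active
   coordinates of an uncovered row a already contribute at least 1/2 to <a, y>.  Give the k-th
   cost the weight w_k = exp (<c_k, x> / (16 L)) with L = ln (4 d), and let the active coordinates
   grow at relative rate a_i / sum_k w_k c_ki, starting from x_i = 1 / (d M_i).  Then the total
   weight grows at rate at most 1 / (16 L), while sum_k w_k sum_i c_ki y_i ln (x_i / x0_i) grows
   at rate at least 1/2; the latter is at most L times the total weight because x_i is capped.
   Hence the total weight never more than doubles, and every <c_k, x> stays O(L log l).
   The optimum is guessed by doubling: every guess is played from the first row, and the answer is
   the running coordinatewise maximum, whose cost is a geometric sum over the guesses.
   Coordinates with M_i = 0 are free and are raised at will. *)

theory Submission
  imports Defs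
begin

section \<open>The problem with every coordinate costly, and its potential function\<close>

locale mixed_covering =
  fixes I :: "'i set" and K :: "'k set" and c :: "'k \<Rightarrow> 'i \<Rightarrow> real" and d :: nat
  assumes finite_I: "finite I" and finite_K: "finite K" and K_nonempty: "K \<noteq> {}"
    and d_ge_2: "d \<ge> 2"
    and c_nonneg: "\<And>k i. k \<in> K \<Longrightarrow> i \<in> I \<Longrightarrow> 0 \<le> c k i"
    and c_pos: "\<And>i. i \<in> I \<Longrightarrow> \<exists>k\<in>K. 0 < c k i"
    and c_sparse: "\<And>k. k \<in> K \<Longrightarrow> card {i \<in> I. c k i \<noteq> 0} \<le> d"
begin

abbreviation dot :: "('i \<Rightarrow> real) \<Rightarrow> ('i \<Rightarrow> real) \<Rightarrow> real" where
  "dot u x \<equiv> \<Sum>i\<in>I. u i * x i"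

text \<open>The scale of coordinate \<open>i\<close>: a nonnegative \<open>x\<close> with
  \<open>cost_le t x\<close> has \<open>x i\<close> at most \<open>t / M i\<close>. This is why
  \<open>c_pos\<close> excludes free coordinates.\<close>

definition M :: "'i \<Rightarrow> real" where
  "M i = Max ((\<lambda>k. c k i) ` K)"

definition covers :: "('i \<Rightarrow> real) list \<Rightarrow> ('i \<Rightarrow> real) \<Rightarrow> bool" where
  "covers rs x \<longleftrightarrow> (\<forall>i\<in>I. 0 \<le> x i) \<and> (\<forall>a\<in>set rs. 1 \<le> dot a x)"

definition cost_le :: "real \<Rightarrow> ('i \<Rightarrow> real) \<Rightarrow> bool" where
  "cost_le t x \<longleftrightarrow> (\<forall>k\<in>K. dot (c k) x \<le> t)"

definition nonneg_rows :: "('i \<Rightarrow> real) list \<Rightarrow> bool" where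
  "nonneg_rows rs \<longleftrightarrow> (\<forall>a\<in>set rs. \<forall>i\<in>I. 0 \<le> a i)"

text \<open>\<open>4 * d\<close> is the ratio of the cap \<open>4 / M i\<close> in
  \<open>box\<close> to the start \<open>x0 i\<close>, so on the box \<open>L\<close> bounds every
  \<open>ln (x i / x0 i)\<close>.\<close>

definition L :: real where "L = ln (4 * real d)"

text \<open>The factor 16 balances one growth step: in \<open>pot_step\<close> the bound on the
  weight gain and the bound on the progress gain divided by \<open>2 * L\<close> both come out as
  \<open>\<delta> / (8 * L)\<close>.\<close>

definition w :: "('i \<Rightarrow> real) \<Rightarrow> 'k \<Rightarrow> real" where
  "w x k = exp (dot (c k) x / (16 * L))"

text \<open>Small enough that by sparsity every cost starts at most 1, yet positive so that
  multiplicative growth can begin.\<close>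

definition x0 :: "'i \<Rightarrow> real" where
  "x0 i = 1 / (real d * M i)"

text \<open>The cap is twice the threshold \<open>2 / M i\<close> of an active coordinate, since one
  step at most doubles a coordinate.\<close>

definition box :: "('i \<Rightarrow> real) \<Rightarrow> bool" where
  "box x \<longleftrightarrow> (\<forall>i\<in>I. x0 i \<le> x i \<and> x i \<le> 4 / M i)"

definition progress :: "('i \<Rightarrow> real) \<Rightarrow> ('i \<Rightarrow> real) \<Rightarrow> 'k \<Rightarrow> real" where
  "progress y x k = (\<Sum>i\<in>I. c k i * y i * ln (x i / x0 i))"

text \<open>For \<open>x\<close> in the box and a nonnegative \<open>y\<close> of cost at most 1,
  the subtracted term is at most half the total weight; at \<open>x0\<close> it vanishes. If
  \<open>pot\<close> never increases, the total weight therefore at most doubles.\<close>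

definition pot :: "('i \<Rightarrow> real) \<Rightarrow> ('i \<Rightarrow> real) \<Rightarrow> real" where
  "pot y x = (\<Sum>k\<in>K. w x k) - (\<Sum>k\<in>K. w x k * progress y x k) / (2 * L)"

section \<open>Bounds from the scales \<open>M i\<close> and from sparsity\<close>

lemma c_le_M: "k \<in> K \<Longrightarrow> c k i \<le> M i"
  unfolding M_def using finite_K by auto

lemma M_attained: "\<exists>k\<in>K. c k i = M i"
proof -
  have "M i \<in> (\<lambda>k. c k i) ` K"
    unfolding M_def using finite_K K_nonempty by (intro Max_in) auto
  then show ?thesis by auto
qed

lemma M_pos: "i \<in> I \<Longrightarrow> 0 < M i"
  using c_pos[of i] c_le_M[of _ i] by fastforce

lemma x0_pos: "i \<in> I \<Longrightarrow> 0 < x0 i"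
  unfolding x0_def using M_pos[of i] d_ge_2 by auto

lemma box_pos: "box x \<Longrightarrow> i \<in> I \<Longrightarrow> 0 < x i"
  unfolding box_def using x0_pos[of i] by fastforce

lemma L_ge_1: "1 \<le> L"
proof -
  have "exp 1 \<le> 4 * real d"
    using exp_le d_ge_2 by linarith
  then show ?thesis
    unfolding L_def using d_ge_2 by (subst ln_ge_iff) auto
qed

text \<open>Each nonzero term is at most 1, and sparsity leaves at most \<open>d\<close> of
  them.\<close>

lemma sum_c_over_M_le:
  assumes "k \<in> K"
  shows "(\<Sum>i\<in>I. c k i / M i) \<le> real d"
proof -
  have "(\<Sum>i\<in>I. c k i / M i) = (\<Sum>i\<in>{i\<in>I. c k i \<noteq> 0}. c k i / M i)"
    using finite_I by (intro sum.mono_neutral_right) auto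
  also have "\<dots> \<le> (\<Sum>i\<in>{i\<in>I. c k i \<noteq> 0}. 1)"
    using c_le_M[OF assms] M_pos by (intro sum_mono) auto
  also have "\<dots> \<le> real d"
    using c_sparse[OF assms] by simp
  finally show ?thesis .
qed

lemma x0_box: "box x0"
  unfolding box_def
proof (intro ballI conjI)
  fix i assume "i \<in> I"
  have "1 \<le> 4 * real d" using d_ge_2 by auto
  then show "x0 i \<le> 4 / M i"
    unfolding x0_def using M_pos[OF \<open>i \<in> I\<close>] d_ge_2 by (simp add: field_simps)
qed simp

lemma dot_x0_le:
  assumes "k \<in> K"
  shows "dot (c k) x0 \<le> 1"
proof -
  have "dot (c k) x0 = (\<Sum>i\<in>I. c k i / M i) / real d"
    by (simp add: x0_def sum_divide_distrib mult.commute)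
  then show ?thesis
    using sum_c_over_M_le[OF assms] d_ge_2 by (simp add: pos_divide_le_eq)
qed

text \<open>Crude, but enough to choose a relative step for which every weight exponent moves by at
  most 1.\<close>

lemma dot_box_le:
  assumes "k \<in> K" "box x"
  shows "dot (c k) x \<le> 4 * real d"
proof -
  have "dot (c k) x \<le> (\<Sum>i\<in>I. 4 * (c k i / M i))"
  proof (rule sum_mono)
    fix i assume i: "i \<in> I"
    have "c k i * x i \<le> c k i * (4 / M i)"
      using assms i c_nonneg by (intro mult_left_mono) (auto simp: box_def)
    then show "c k i * x i \<le> 4 * (c k i / M i)" by (simp add: mult.commute)
  qed
  also have "\<dots> = 4 * (\<Sum>i\<in>I. c k i / M i)" by (simp add: sum_distrib_left)
  finally show ?thesis using sum_c_over_M_le[OF assms(1)] by linarith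
qed

lemma cost_le_imp_le:
  assumes "cost_le t y" "\<forall>i\<in>I. 0 \<le> y i" "i \<in> I"
  shows "y i \<le> t / M i"
proof -
  obtain k where k: "k \<in> K" "c k i = M i" using M_attained by blast
  have "c k i * y i \<le> dot (c k) y"
    using assms c_nonneg[OF k(1)] finite_I by (intro member_le_sum) auto
  also have "\<dots> \<le> t" using assms(1) k(1) by (auto simp: cost_le_def)
  finally show ?thesis using M_pos[OF assms(3)] k by (simp add: field_simps)
qed

section \<open>Progress towards a comparison vector, and one growth step\<close>

lemma progress_nonneg:
  assumes "box x" "\<forall>i\<in>I. 0 \<le> y i" "k \<in> K"
  shows "0 \<le> progress y x k"
  unfolding progress_def
  using assms c_nonneg x0_pos by (intro sum_nonneg mult_nonneg_nonneg) (auto simp: box_def)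

lemma progress_le:
  assumes "box x" "\<forall>i\<in>I. 0 \<le> y i" "cost_le 1 y" "k \<in> K"
  shows "progress y x k \<le> L"
proof -
  have "progress y x k \<le> (\<Sum>i\<in>I. c k i * y i * L)"
    unfolding progress_def
  proof (rule sum_mono)
    fix i assume i: "i \<in> I"
    have "x i / x0 i \<le> (4 / M i) / x0 i"
      using assms(1) i x0_pos[OF i] by (intro divide_right_mono) (auto simp: box_def)
    also have "\<dots> = 4 * real d"
      unfolding x0_def using M_pos[OF i] by simp
    finally have "ln (x i / x0 i) \<le> L"
      unfolding L_def using box_pos[OF assms(1) i] x0_pos[OF i] by (intro ln_mono) auto
    then show "c k i * y i * ln (x i / x0 i) \<le> c k i * y i * L"
      using assms c_nonneg i by (intro mult_left_mono) auto
  qed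
  also have "\<dots> = dot (c k) y * L" by (simp add: sum_distrib_right)
  also have "\<dots> \<le> 1 * L"
    using assms(3,4) L_ge_1 by (intro mult_right_mono) (auto simp: cost_le_def)
  finally show ?thesis by simp
qed

text \<open>A discretised form of the continuous growth. \<open>z\<close> guarantees an active
  coordinate; the step itself is chosen without looking at \<open>y\<close>, so the potential does
  not rise for any comparison vector. The growth of the product of the coordinates will bound the
  number of steps.\<close>

lemma pot_step:
  assumes x: "box x" and a: "\<forall>i\<in>I. 0 \<le> a i" and lt: "dot a x < 1"
    and ex: "covers [a] z" "cost_le 1 z"
  shows "\<exists>x'. box x' \<and> (\<forall>i\<in>I. x i \<le> x' i) \<and>
     (1 + 1 / (4 * real d)) * (\<Prod>i\<in>I. x i) \<le> (\<Prod>i\<in>I. x' i) \<and>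
     (\<forall>y. covers [a] y \<longrightarrow> cost_le 1 y \<longrightarrow> pot y x' \<le> pot y x)"
proof -
  \<comment> \<open>By \<open>dot_box_le\<close> every cost is at most \<open>4 * d\<close>, so
    relative growth by at most \<open>e\<close> raises it by at most 1. Also
    \<open>e \<le> 1\<close> keeps the step within the cap of \<open>box\<close>.\<close>
  define e where "e = 1 / (4 * real d)"
  have e: "0 < e" "e \<le> 1" using d_ge_2 by (auto simp: e_def)
  define Act where "Act = {i \<in> I. 0 < a i \<and> x i < 2 / M i}"
  have Act_sub: "Act \<subseteq> I" and fin_Act: "finite Act"
    using finite_I by (auto simp: Act_def)
  have act_half: "1 / 2 \<le> (\<Sum>i\<in>Act. a i * y i)" if "covers [a] y" "cost_le 1 y" for y
  proof -
    have y0: "\<forall>i\<in>I. 0 \<le> y i" and ay: "1 \<le> dot a y"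
      using that(1) by (auto simp: covers_def)
    \<comment> \<open>Inactive coordinates carry at most half of the cover by \<open>y\<close>:
      where \<open>a i\<close> is nonzero, \<open>x i\<close> is at least \<open>2 / M i\<close>,
      twice the bound \<open>1 / M i\<close> on \<open>y i\<close>, and
      \<open>dot a x < 1\<close>.\<close>
    have "(\<Sum>i\<in>I - Act. a i * y i) \<le> (\<Sum>i\<in>I - Act. a i * x i / 2)"
    proof (rule sum_mono)
      fix i assume i: "i \<in> I - Act"
      then have "a i = 0 \<or> 2 / M i \<le> x i" using a by (fastforce simp: Act_def)
      moreover have "y i \<le> 1 / M i" using cost_le_imp_le[OF that(2) y0] i by auto
      ultimately have "a i = 0 \<or> y i \<le> x i / 2" by (auto simp: field_simps)
      then show "a i * y i \<le> a i * x i / 2"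
        using a i mult_left_mono[of "y i" "x i / 2" "a i"] by auto
    qed
    also have "\<dots> \<le> (\<Sum>i\<in>I. a i * x i / 2)"
      using a box_pos[OF x] finite_I by (intro sum_mono2) (auto simp: less_imp_le)
    also have "\<dots> = dot a x / 2" by (simp add: sum_divide_distrib)
    finally have "(\<Sum>i\<in>I - Act. a i * y i) \<le> 1 / 2" using lt by linarith
    moreover have "dot a y = (\<Sum>i\<in>I - Act. a i * y i) + (\<Sum>i\<in>Act. a i * y i)"
      using finite_I Act_sub by (rule sum.subset_diff[rotated])
    ultimately show ?thesis using ay by linarith
  qed
  have "Act \<noteq> {}" using act_half[OF ex] by auto
  \<comment> \<open>Up to the factor \<open>16 * L\<close>, the derivative of the total weight in
    direction \<open>i\<close>.\<close>
  define G where "G i = (\<Sum>k\<in>K. w x k * c k i)" for i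
  have G_pos: "0 < G i" if i: "i \<in> I" for i
  proof -
    obtain k where "k \<in> K" "0 < c k i" using c_pos[OF i] by blast
    then show ?thesis
      unfolding G_def using finite_K c_nonneg i
      by (intro sum_pos2[where i = k]) (auto simp: w_def)
  qed
  \<comment> \<open>\<open>j\<close> is the active coordinate of fastest relative growth. Scaling
    the step so that \<open>j\<close> grows by exactly the factor \<open>1 + e\<close> keeps all
    others at or below it.\<close>
  obtain j where j: "j \<in> Act" "\<And>i. i \<in> Act \<Longrightarrow> G j / a j \<le> G i / a i"
    using fin_Act \<open>Act \<noteq> {}\<close> by (meson arg_min_if_finite not_le)
  have aj: "0 < a j" "j \<in> I" using j(1) by (auto simp: Act_def)
  define \<delta> where "\<delta> = e * (G j / a j)"
  have \<delta>: "0 < \<delta>" using e G_pos aj by (auto simp: \<delta>_def)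
  define r where "r i = (if i \<in> Act then \<delta> * a i / G i else 0)" for i
  have r0: "0 \<le> r i" if "i \<in> I" for i
    using \<delta> G_pos[OF that] a that by (auto simp: r_def)
  have re: "r i \<le> e" if "i \<in> I" for i
  proof (cases "i \<in> Act")
    case True
    have "0 < a i" using True by (auto simp: Act_def)
    have "\<delta> * a i / G i \<le> e * (G i / a i) * a i / G i"
      unfolding \<delta>_def using j(2)[OF True] e G_pos[OF that] \<open>0 < a i\<close>
      by (intro divide_right_mono mult_right_mono mult_left_mono) auto
    also have "\<dots> = e" using G_pos[OF that] \<open>0 < a i\<close> by simp
    finally show ?thesis using True by (simp add: r_def)
  qed (use e in \<open>auto simp: r_def\<close>)
  have rj: "r j = e" using j(1) aj G_pos[OF aj(2)] by (simp add: r_def \<delta>_def)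
  define x' where "x' i = x i * (1 + r i)" for i
  have le: "x i \<le> x' i" if "i \<in> I" for i
    using r0[OF that] box_pos[OF x that] by (simp add: x'_def algebra_simps)
  have box': "box x'"
    unfolding box_def
  proof (intro ballI conjI)
    fix i assume i: "i \<in> I"
    show "x0 i \<le> x' i" using le[OF i] x i by (fastforce simp: box_def)
    show "x' i \<le> 4 / M i"
    proof (cases "i \<in> Act")
      case True
      have "x' i \<le> x i * 2"
        unfolding x'_def using re[OF i] e box_pos[OF x i] by (intro mult_left_mono) auto
      moreover have "x i < 2 / M i" using True by (simp add: Act_def)
      ultimately show ?thesis by auto
    qed (use x i in \<open>auto simp: x'_def r_def box_def\<close>)
  qed
  have "(1 + e) * (\<Prod>i\<in>I. x i) \<le> (\<Prod>i\<in>I. x' i)"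
  proof -
    have "(\<Prod>i\<in>I. x' i) = (\<Prod>i\<in>I. x i) * (\<Prod>i\<in>I. 1 + r i)"
      by (simp add: x'_def prod.distrib)
    moreover have "(\<Prod>i\<in>I. 1 + r i) = (1 + e) * (\<Prod>i\<in>I - {j}. 1 + r i)"
      using prod.remove[OF finite_I aj(2), of "\<lambda>i. 1 + r i"] rj by simp
    moreover have "1 \<le> (\<Prod>i\<in>I - {j}. 1 + r i)"
      using r0 by (intro prod_ge_1) auto
    moreover have "0 \<le> (\<Prod>i\<in>I. x i)"
      using box_pos[OF x] by (intro prod_nonneg) (auto simp: less_imp_le)
    ultimately show ?thesis
      using e mult_left_mono[of 1 "\<Prod>i\<in>I - {j}. 1 + r i" "(1 + e) * (\<Prod>i\<in>I. x i)"]
      by (simp add: mult_ac)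
  qed
  moreover have "pot y x' \<le> pot y x" if y: "covers [a] y" "cost_le 1 y" for y
  proof -
    have y0: "\<forall>i\<in>I. 0 \<le> y i" using y(1) by (auto simp: covers_def)
    \<comment> \<open>\<open>v k\<close> is the increase of the exponent of the weight of
      \<open>k\<close>. It stays in the unit interval, where \<open>exp t\<close> is at most
      \<open>1 + 2 * t\<close>.\<close>
    define v where "v k = (\<Sum>i\<in>I. c k i * (x i * r i)) / (16 * L)" for k
    have v0: "0 \<le> v k" if "k \<in> K" for k
      unfolding v_def using c_nonneg[OF that] box_pos[OF x] r0 L_ge_1
      by (intro divide_nonneg_nonneg sum_nonneg mult_nonneg_nonneg) (auto simp: less_imp_le)
    have v1: "v k \<le> 1" if k: "k \<in> K" for k
    proof -
      have "(\<Sum>i\<in>I. c k i * (x i * r i)) \<le> (\<Sum>i\<in>I. c k i * (x i * e))"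
        using c_nonneg[OF k] box_pos[OF x] re
        by (intro sum_mono mult_left_mono) (auto simp: less_imp_le)
      also have "\<dots> = e * dot (c k) x" by (simp add: sum_distrib_left mult_ac)
      also have "\<dots> \<le> e * (4 * real d)"
        using dot_box_le[OF k x] e by (intro mult_left_mono) auto
      also have "\<dots> = 1" using d_ge_2 by (simp add: e_def)
      finally show ?thesis unfolding v_def using L_ge_1 by simp
    qed
    have w': "w x' k = w x k * exp (v k)" for k
      by (simp add: w_def v_def x'_def exp_add[symmetric] add_divide_distrib[symmetric]
          sum.distrib[symmetric] algebra_simps)
    have exp_le_lin: "exp t \<le> 1 + 2 * t" if "0 \<le> t" "t \<le> 1" for t :: real
      using exp_bound[OF that] that mult_left_mono[of t 1 t]
      by (simp add: power2_eq_square)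
    have "(\<Sum>k\<in>K. w x' k) - (\<Sum>k\<in>K. w x k) = (\<Sum>k\<in>K. w x k * (exp (v k) - 1))"
      by (simp add: w' sum_subtractf algebra_simps)
    also have "\<dots> \<le> (\<Sum>k\<in>K. w x k * (2 * v k))"
    proof (intro sum_mono mult_left_mono)
      fix k assume "k \<in> K"
      then show "exp (v k) - 1 \<le> 2 * v k" using exp_le_lin[OF v0 v1] by force
    qed (simp add: w_def)
    also have "\<dots> = (\<Sum>k\<in>K. \<Sum>i\<in>I. w x k * c k i * (x i * r i)) / (8 * L)"
      by (simp add: v_def sum_divide_distrib sum_distrib_left mult_ac)
    \<comment> \<open>Exchanging the sums produces \<open>G i\<close>, which cancels against the
      denominator of \<open>r i\<close>. What remains is \<open>\<delta>\<close> times the active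
      part of \<open>dot a x\<close>, which is below 1 as the row is uncovered.\<close>
    also have "(\<Sum>k\<in>K. \<Sum>i\<in>I. w x k * c k i * (x i * r i)) = (\<Sum>i\<in>I. G i * (x i * r i))"
      by (subst sum.swap) (simp add: G_def sum_distrib_right)
    also have "\<dots> = (\<Sum>i\<in>Act. G i * (x i * r i))"
      using finite_I Act_sub by (intro sum.mono_neutral_right) (auto simp: r_def)
    also have "\<dots> = (\<Sum>i\<in>Act. \<delta> * (a i * x i))"
      using G_pos Act_sub by (intro sum.cong refl) (force simp: r_def)
    also have "\<dots> = \<delta> * (\<Sum>i\<in>Act. a i * x i)" by (simp add: sum_distrib_left)
    also have "\<dots> / (8 * L) \<le> \<delta> * 1 / (8 * L)"
    proof -
      have "(\<Sum>i\<in>Act. a i * x i) \<le> dot a x"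
        using a box_pos[OF x] finite_I Act_sub
        by (intro sum_mono2) (auto simp: less_imp_le)
      then show ?thesis
        using lt \<delta> L_ge_1 by (intro divide_right_mono mult_left_mono) auto
    qed
    finally have W: "(\<Sum>k\<in>K. w x' k) - (\<Sum>k\<in>K. w x k) \<le> \<delta> / (8 * L)" by simp
    have ln_ge: "t / 2 \<le> ln (1 + t)" if "0 \<le> t" "t \<le> 1" for t :: real
    proof -
      have "- ln (1 + t) \<le> 1 / (1 + t) - 1"
        using that ln_le_minus_one[of "1 / (1 + t)"] by (simp add: ln_div)
      moreover have "1 / (1 + t) - 1 \<le> - (t / 2)"
        using that mult_left_mono[of t 1 t] by (simp add: field_simps)
      ultimately show ?thesis by linarith
    qed
    \<comment> \<open>The same cancellation with \<open>y\<close> in place of \<open>x\<close> turns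
      the active half of the cover by \<open>y\<close> into a lower bound for the progress.\<close>
    have "\<delta> / 4 \<le> \<delta> / 2 * (\<Sum>i\<in>Act. a i * y i)"
      using mult_left_mono[OF act_half[OF y], of "\<delta> / 2"] \<delta> by simp
    also have "\<dots> = (\<Sum>i\<in>Act. G i * (y i * (r i / 2)))"
      unfolding sum_distrib_left
      using G_pos Act_sub by (intro sum.cong refl) (force simp: r_def)
    also have "\<dots> = (\<Sum>i\<in>I. G i * (y i * (r i / 2)))"
      using finite_I Act_sub by (intro sum.mono_neutral_left) (auto simp: r_def)
    also have "\<dots> = (\<Sum>k\<in>K. \<Sum>i\<in>I. w x k * c k i * (y i * (r i / 2)))"
      by (subst sum.swap) (simp add: G_def sum_distrib_right sum_divide_distrib)
    also have "\<dots> = (\<Sum>k\<in>K. w x k * (\<Sum>i\<in>I. c k i * y i * (r i / 2)))"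
      by (simp add: sum_distrib_left mult_ac)
    also have "\<dots> \<le> (\<Sum>k\<in>K. w x k * (progress y x' k - progress y x k))"
    proof (intro sum_mono mult_left_mono)
      fix k assume k: "k \<in> K"
      have "(\<Sum>i\<in>I. c k i * y i * (r i / 2)) \<le> (\<Sum>i\<in>I. c k i * y i * ln (1 + r i))"
      proof (intro sum_mono mult_left_mono)
        fix i assume i: "i \<in> I"
        show "r i / 2 \<le> ln (1 + r i)" using r0[OF i] re[OF i] e by (intro ln_ge) auto
        show "0 \<le> c k i * y i" using c_nonneg[OF k i] y0 i by simp
      qed
      also have "\<dots> = progress y x' k - progress y x k"
        unfolding progress_def sum_subtractf[symmetric]
      proof (intro sum.cong refl)
        fix i assume i: "i \<in> I"
        have "ln (x' i / x0 i) = ln (x i / x0 i) + ln (1 + r i)"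
          using ln_mult_pos[of "x i / x0 i" "1 + r i"] box_pos[OF x i] x0_pos[OF i] r0[OF i]
          by (simp add: x'_def)
        then show "c k i * y i * ln (1 + r i) =
            c k i * y i * ln (x' i / x0 i) - c k i * y i * ln (x i / x0 i)"
          by (simp add: algebra_simps)
      qed
      finally show "(\<Sum>i\<in>I. c k i * y i * (r i / 2)) \<le> progress y x' k - progress y x k" .
    qed (simp add: w_def)
    \<comment> \<open>\<open>progress\<close> is nonnegative, so at the new point the old weight may
      be replaced by the larger new one.\<close>
    also have "\<dots> \<le> (\<Sum>k\<in>K. w x' k * progress y x' k - w x k * progress y x k)"
    proof (intro sum_mono)
      fix k assume k: "k \<in> K"
      have "w x k \<le> w x' k" using w' v0[OF k] by (simp add: w_def)
      then have "w x k * progress y x' k \<le> w x' k * progress y x' k"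
        using progress_nonneg[OF box' y0 k] by (intro mult_right_mono)
      then show "w x k * (progress y x' k - progress y x k)
          \<le> w x' k * progress y x' k - w x k * progress y x k"
        by (simp add: algebra_simps)
    qed
    also have "\<dots> = (\<Sum>k\<in>K. w x' k * progress y x' k) - (\<Sum>k\<in>K. w x k * progress y x k)"
      by (simp add: sum_subtractf)
    finally have "\<delta> / 4 / (2 * L) \<le> ((\<Sum>k\<in>K. w x' k * progress y x' k) -
        (\<Sum>k\<in>K. w x k * progress y x k)) / (2 * L)"
      using L_ge_1 by (intro divide_right_mono) auto
    then show ?thesis using W by (simp add: pot_def diff_divide_distrib)
  qed
  ultimately show ?thesis
    using box' le unfolding e_def by (intro exI[of _ x']) auto
qed

section \<open>Answering rows one after the other\<close>

definition answers :: "('i \<Rightarrow> real) \<Rightarrow> ('i \<Rightarrow> real) \<Rightarrow> ('i \<Rightarrow> real) \<Rightarrow> bool" where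
  "answers x a x' \<longleftrightarrow> box x' \<and> (\<forall>i\<in>I. x i \<le> x' i) \<and> 1 \<le> dot a x' \<and>
     (\<forall>y. covers [a] y \<longrightarrow> cost_le 1 y \<longrightarrow> pot y x' \<le> pot y x)"

text \<open>As long as \<open>a\<close> is uncovered, \<open>pot_step\<close> applies again and
  multiplies the product of the coordinates by at least \<open>q > 1\<close>, while
  \<open>box\<close> bounds that product. The potential clause of \<open>answers\<close> ranges over
  every \<open>y\<close> because the vector that covers all later rows is not yet known.\<close>

lemma answer_exists:
  assumes x: "box x" and a: "\<forall>i\<in>I. 0 \<le> a i" and ex: "covers [a] z" "cost_le 1 z"
  shows "\<exists>x'. answers x a x'"
proof (rule ccontr)
  assume none: "\<nexists>x'. answers x a x'"
  define q where "q = 1 + 1 / (4 * real d)"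
  have q: "1 < q" using d_ge_2 by (simp add: q_def)
  have steps: "\<exists>x'. box x' \<and> (\<forall>i\<in>I. x i \<le> x' i) \<and> q ^ N * (\<Prod>i\<in>I. x i) \<le> (\<Prod>i\<in>I. x' i) \<and>
      (\<forall>y. covers [a] y \<longrightarrow> cost_le 1 y \<longrightarrow> pot y x' \<le> pot y x)" for N
  proof (induction N)
    case 0
    show ?case using x by (intro exI[of _ x]) auto
  next
    case (Suc N)
    then obtain x' where x': "box x'" "\<forall>i\<in>I. x i \<le> x' i"
        "q ^ N * (\<Prod>i\<in>I. x i) \<le> (\<Prod>i\<in>I. x' i)"
        "\<forall>y. covers [a] y \<longrightarrow> cost_le 1 y \<longrightarrow> pot y x' \<le> pot y x"
      by blast
    have "dot a x' < 1" using none x'(1,2,4) unfolding answers_def by (meson not_le)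
    from pot_step[OF x'(1) a this ex] obtain x'' where x'': "box x''" "\<forall>i\<in>I. x' i \<le> x'' i"
        "q * (\<Prod>i\<in>I. x' i) \<le> (\<Prod>i\<in>I. x'' i)"
        "\<forall>y. covers [a] y \<longrightarrow> cost_le 1 y \<longrightarrow> pot y x'' \<le> pot y x'"
      unfolding q_def by blast
    have "q ^ Suc N * (\<Prod>i\<in>I. x i) \<le> q * (\<Prod>i\<in>I. x' i)"
      using mult_left_mono[OF x'(3), of q] q by (simp add: mult_ac)
    then have "q ^ Suc N * (\<Prod>i\<in>I. x i) \<le> (\<Prod>i\<in>I. x'' i)"
      using x''(3) by linarith
    moreover have "\<forall>i\<in>I. x i \<le> x'' i" using x'(2) x''(2) order_trans by blast
    moreover have "\<forall>y. covers [a] y \<longrightarrow> cost_le 1 y \<longrightarrow> pot y x'' \<le> pot y x"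
      using x'(4) x''(4) order_trans by blast
    ultimately show ?case using x''(1) by blast
  qed
  have P: "0 < (\<Prod>i\<in>I. x i)" using box_pos[OF x] by (intro prod_pos) auto
  obtain N where N: "(\<Prod>i\<in>I. 4 / M i) / (\<Prod>i\<in>I. x i) < q ^ N"
    using real_arch_pow[OF q] by blast
  obtain x' where x': "box x'" "q ^ N * (\<Prod>i\<in>I. x i) \<le> (\<Prod>i\<in>I. x' i)" using steps by blast
  have "(\<Prod>i\<in>I. x' i) \<le> (\<Prod>i\<in>I. 4 / M i)"
    using x'(1) box_pos[OF x'(1)] by (intro prod_mono) (auto simp: box_def less_imp_le)
  then show False using N P x'(2) by (simp add: field_simps)
qed

text \<open>The total weight is at most twice its value at \<open>x0\<close>, where each weight is
  at most \<open>exp 1\<close>. A single weight is at most the total, and its logarithm is the cost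
  up to the factor \<open>16 * L\<close>.\<close>

lemma cost_of_pot_le:
  assumes x: "box x" and y: "\<forall>i\<in>I. 0 \<le> y i" "cost_le 1 y" and le: "pot y x \<le> pot y x0"
  shows "cost_le (16 * L * ln (2 * exp 1 * real (card K))) x"
  unfolding cost_le_def
proof
  fix k assume k: "k \<in> K"
  have "(\<Sum>k\<in>K. w x k * progress y x k) \<le> (\<Sum>k\<in>K. w x k) * L"
    unfolding sum_distrib_right
    using progress_le[OF x y] by (intro sum_mono mult_left_mono) (auto simp: w_def)
  then have "(\<Sum>k\<in>K. w x k * progress y x k) / (2 * L) \<le> (\<Sum>k\<in>K. w x k) / 2"
    using L_ge_1 by (simp add: pos_divide_le_eq mult_ac)
  moreover have "progress y x0 k = 0" for k
    unfolding progress_def by (intro sum.neutral) (use x0_pos in force)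
  ultimately have W: "(\<Sum>k\<in>K. w x k) \<le> 2 * (\<Sum>k\<in>K. w x0 k)"
    using le by (simp add: pot_def)
  have "w x0 k \<le> exp 1" if "k \<in> K" for k
    using dot_x0_le[OF that] L_ge_1 by (simp add: w_def field_simps)
  then have "(\<Sum>k\<in>K. w x0 k) \<le> real (card K) * exp 1"
    by (rule sum_bounded_above)
  moreover have "w x k \<le> (\<Sum>k\<in>K. w x k)"
    using k finite_K by (intro member_le_sum) (auto simp: w_def)
  ultimately have *: "w x k \<le> 2 * exp 1 * real (card K)" using W by (simp add: mult_ac)
  have "0 < card K" using finite_K K_nonempty by (simp add: card_gt_0_iff)
  then have "dot (c k) x / (16 * L) \<le> ln (2 * exp 1 * real (card K))"
    using * by (subst ln_ge_iff) (auto simp: w_def)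
  then show "dot (c k) x \<le> 16 * L * ln (2 * exp 1 * real (card K))"
    using L_ge_1 by (simp add: field_simps)
qed

text \<open>Without a covering vector of cost at most 1 no answer need exist, and the values of
  \<open>phase\<close> are then arbitrary.\<close>

definition phase :: "('i \<Rightarrow> real) list \<Rightarrow> 'i \<Rightarrow> real" where
  "phase rs = foldl (\<lambda>x a. SOME x'. answers x a x') x0 rs"

lemma phase_snoc:
  assumes "nonneg_rows (rs @ [a])" "covers (rs @ [a]) z" "cost_le 1 z" "box (phase rs)"
  shows "answers (phase rs) a (phase (rs @ [a]))"
proof -
  have "\<exists>x'. answers (phase rs) a x'"
    using assms by (intro answer_exists) (auto simp: covers_def nonneg_rows_def)
  then show ?thesis unfolding phase_def by (simp add: someI_ex)
qed

text \<open>A vector \<open>z\<close> covering the whole list covers each of its prefixes, so it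
  serves as comparison vector for every answer.\<close>

lemma phase_invariant:
  assumes "nonneg_rows rs" "covers rs z" "cost_le 1 z"
  shows "box (phase rs) \<and> pot z (phase rs) \<le> pot z x0"
  using assms
proof (induction rs rule: rev_induct)
  case Nil
  then show ?case by (simp add: phase_def x0_box)
next
  case (snoc a rs)
  have IH: "box (phase rs)" "pot z (phase rs) \<le> pot z x0"
    using snoc by (auto simp: nonneg_rows_def covers_def)
  have "answers (phase rs) a (phase (rs @ [a]))"
    using snoc.prems IH by (intro phase_snoc)
  moreover have "covers [a] z" using snoc.prems by (auto simp: covers_def)
  ultimately show ?case using IH snoc.prems(3) by (force simp: answers_def)
qed

lemma phase_cost:
  assumes "nonneg_rows rs" "covers rs z" "cost_le 1 z"
  shows "cost_le (16 * L * ln (2 * exp 1 * real (card K))) (phase rs)"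
  using phase_invariant[OF assms] assms by (intro cost_of_pot_le) (auto simp: covers_def)

section \<open>The algorithm for a fixed guess of the optimum\<close>

definition ratio :: real where
  "ratio = 16 * L * ln (2 * exp 1 * real (card K))"

lemma ratio_nonneg: "0 \<le> ratio"
proof -
  have "1 \<le> card K" using finite_K K_nonempty by (simp add: Suc_le_eq card_gt_0_iff)
  moreover have "1 \<le> 2 * exp (1 :: real)" using exp_ge_add_one_self[of 1] by linarith
  ultimately have "1 * 1 \<le> 2 * exp 1 * real (card K)"
    by (intro mult_mono) auto
  then show ?thesis using L_ge_1 by (auto simp: ratio_def)
qed

text \<open>The existential hides \<open>phase\<close>, so that the statement transfers to a
  rescaled instance of the locale, whose \<open>phase\<close> is a different function.\<close>

lemma unit_guess_algorithm:
  "\<exists>B. \<forall>rs z. nonneg_rows rs \<longrightarrow> covers rs z \<longrightarrow> cost_le 1 z \<longrightarrow>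
     (\<forall>i\<in>I. 0 \<le> B rs i) \<and> cost_le ratio (B rs) \<and>
     (\<forall>rs' a. rs = rs' @ [a] \<longrightarrow> (\<forall>i\<in>I. B rs' i \<le> B rs i) \<and> 1 \<le> dot a (B rs))"
proof (intro exI allI impI)
  fix rs z assume z: "nonneg_rows rs" "covers rs z" "cost_le 1 z"
  have "\<forall>i\<in>I. 0 \<le> phase rs i"
    using box_pos phase_invariant[OF z] by (auto simp: less_imp_le)
  moreover have "cost_le ratio (phase rs)"
    using phase_cost[OF z] by (simp add: ratio_def)
  moreover have "(\<forall>i\<in>I. phase rs' i \<le> phase rs i) \<and> 1 \<le> dot a (phase rs)"
    if "rs = rs' @ [a]" for rs' a
  proof -
    have "nonneg_rows rs'" "covers rs' z"
      using z that by (auto simp: nonneg_rows_def covers_def)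
    then have "box (phase rs')" using phase_invariant z(3) by blast
    then show ?thesis using phase_snoc z that by (auto simp: answers_def)
  qed
  ultimately show "(\<forall>i\<in>I. 0 \<le> phase rs i) \<and> cost_le ratio (phase rs) \<and>
     (\<forall>rs' a. rs = rs' @ [a] \<longrightarrow> (\<forall>i\<in>I. phase rs' i \<le> phase rs i) \<and> 1 \<le> dot a (phase rs))"
    by blast
qed

text \<open>Dividing all costs by \<open>t\<close> turns cost at most \<open>t\<close> into cost at
  most 1. Neither \<open>d\<close> nor the number of costs changes, so \<open>ratio\<close> stays
  the same.\<close>

lemma guess_algorithm:
  assumes t: "0 < t"
  shows "\<exists>B. \<forall>rs z. nonneg_rows rs \<longrightarrow> covers rs z \<longrightarrow> cost_le t z \<longrightarrow>
     (\<forall>i\<in>I. 0 \<le> B rs i) \<and> cost_le (ratio * t) (B rs) \<and>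
     (\<forall>rs' a. rs = rs' @ [a] \<longrightarrow> (\<forall>i\<in>I. B rs' i \<le> B rs i) \<and> 1 \<le> dot a (B rs))"
proof -
  interpret scaled: mixed_covering I K "\<lambda>k i. c k i / t" d
  proof
    show "\<exists>k\<in>K. 0 < c k i / t" if "i \<in> I" for i
      using c_pos[OF that] t divide_pos_pos by blast
  qed (use finite_I finite_K K_nonempty d_ge_2 c_nonneg c_sparse t in auto)
  have cost_le_scaled: "scaled.cost_le s x \<longleftrightarrow> cost_le (s * t) x" for s x
    using t by (simp add: scaled.cost_le_def cost_le_def sum_divide_distrib[symmetric]
        pos_divide_le_eq)
  show ?thesis
    using scaled.unit_guess_algorithm
    unfolding cost_le_scaled scaled.ratio_def scaled.L_def ratio_def L_def
      scaled.covers_def covers_def scaled.nonneg_rows_def nonneg_rows_def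
    by simp
qed

section \<open>The optimum of the rows seen so far and its guess by a power of two\<close>

definition proper_rows :: "('i \<Rightarrow> real) list \<Rightarrow> bool" where
  "proper_rows rs \<longleftrightarrow> nonneg_rows rs \<and> (\<forall>a\<in>set rs. \<exists>i\<in>I. a i \<noteq> 0)"

definition opt :: "('i \<Rightarrow> real) list \<Rightarrow> real" where
  "opt rs = Inf {t. \<exists>x. covers rs x \<and> cost_le t x}"

text \<open>The \<open>+ 1\<close> makes the guess exceed a positive optimum strictly, so a covering
  vector within the guess exists without showing that the infimum is attained. The guess is still at
  most twice the optimum.\<close>

definition level :: "('i \<Rightarrow> real) list \<Rightarrow> int" where
  "level rs = \<lfloor>log 2 (opt rs)\<rfloor> + 1"

definition guess :: "('i \<Rightarrow> real) list \<Rightarrow> real" where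
  "guess rs = 2 powr real_of_int (level rs)"

lemma cost_le_mono:
  assumes "cost_le t y" "\<forall>i\<in>I. x i \<le> y i" "t \<le> s"
  shows "cost_le s x"
  unfolding cost_le_def
proof
  fix k assume k: "k \<in> K"
  have "dot (c k) x \<le> dot (c k) y"
    using assms(2) c_nonneg[OF k] by (intro sum_mono mult_left_mono) auto
  then show "dot (c k) x \<le> s" using assms(1,3) k by (force simp: cost_le_def)
qed

lemma cost_le_add:
  assumes "cost_le s x" "cost_le t y"
  shows "cost_le (s + t) (\<lambda>i. x i + y i)"
  using assms by (auto simp: cost_le_def algebra_simps sum.distrib intro!: add_mono)

lemma exists_covers:
  assumes "proper_rows rs"
  shows "\<exists>x t. covers rs x \<and> cost_le t x"
proof (intro exI conjI)
  \<comment> \<open>Since \<open>1 / 0 = 0\<close>, a row adds to coordinate \<open>i\<close> only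
    if its entry there is nonzero, and then just enough for \<open>i\<close> alone to cover
    it.\<close>
  let ?x = "\<lambda>i. \<Sum>a\<leftarrow>rs. 1 / \<bar>a i\<bar>"
  have x0: "0 \<le> ?x i" for i by (intro sum_list_nonneg) auto
  show "covers rs ?x"
    unfolding covers_def
  proof (intro conjI ballI x0)
    fix a assume a: "a \<in> set rs"
    have a0: "\<forall>i\<in>I. 0 \<le> a i"
      using assms a by (auto simp: proper_rows_def nonneg_rows_def)
    obtain i where i: "i \<in> I" "a i \<noteq> 0" using assms a by (auto simp: proper_rows_def)
    have "1 / \<bar>a i\<bar> \<le> ?x i" using a by (intro member_le_sum_list) auto
    then have "a i * (1 / \<bar>a i\<bar>) \<le> a i * ?x i" using a0 i by (intro mult_left_mono) auto
    then have "1 \<le> a i * ?x i" using a0 i by simp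
    also have "\<dots> \<le> dot a ?x"
      using a0 x0 i finite_I by (intro member_le_sum) auto
    finally show "1 \<le> dot a ?x" .
  qed
  show "cost_le (Max ((\<lambda>k. dot (c k) ?x) ` K)) ?x"
    unfolding cost_le_def using finite_K by auto
qed

lemma cost_nonneg:
  assumes "covers rs x" "cost_le t x"
  shows "0 \<le> t"
proof -
  obtain k where k: "k \<in> K" using K_nonempty by blast
  have "0 \<le> dot (c k) x"
    using c_nonneg[OF k] assms(1) by (intro sum_nonneg mult_nonneg_nonneg) (auto simp: covers_def)
  then show ?thesis using assms(2) k by (force simp: cost_le_def)
qed

lemma opt_le:
  assumes "covers rs x" "cost_le t x"
  shows "opt rs \<le> t"
  unfolding opt_def
proof (rule cInf_lower)
  show "bdd_below {t. \<exists>x. covers rs x \<and> cost_le t x}"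
    using cost_nonneg by (intro bdd_belowI[of _ 0]) auto
qed (use assms in blast)

text \<open>The logarithm in \<open>level\<close> calls for a positive optimum. Cost at most
  \<open>t\<close> forces \<open>x i\<close> to be at most \<open>t / M i\<close>, so already one
  row \<open>a\<close> costs at least the reciprocal of the sum of the
  \<open>a i / M i\<close>.\<close>

lemma opt_pos:
  assumes rs: "proper_rows rs" and "rs \<noteq> []"
  shows "0 < opt rs"
proof -
  obtain a where a: "a \<in> set rs" using \<open>rs \<noteq> []\<close> by fastforce
  define S where "S = (\<Sum>i\<in>I. a i / M i)"
  have a0: "\<forall>i\<in>I. 0 \<le> a i" using rs a by (auto simp: proper_rows_def nonneg_rows_def)
  have bound: "1 \<le> t * S" if "covers rs x" "cost_le t x" for t x
  proof -
    have x0: "\<forall>i\<in>I. 0 \<le> x i" using that by (auto simp: covers_def)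
    have "1 \<le> dot a x" using that a by (auto simp: covers_def)
    also have "dot a x \<le> (\<Sum>i\<in>I. a i * (t / M i))"
      using a0 cost_le_imp_le[OF that(2) x0] by (intro sum_mono mult_left_mono) auto
    also have "\<dots> = t * S" by (simp add: S_def sum_distrib_left mult_ac)
    finally show ?thesis .
  qed
  obtain x t where xt: "covers rs x" "cost_le t x" using exists_covers[OF rs] by blast
  have "0 \<le> S" unfolding S_def using a0 M_pos by (intro sum_nonneg) (auto simp: less_imp_le)
  then have S: "0 < S" using bound[OF xt] by (cases "S = 0") auto
  have "1 / S \<le> opt rs"
    unfolding opt_def using xt bound S by (intro cInf_greatest) (auto simp: pos_divide_le_eq)
  then show ?thesis using S by (auto intro: less_le_trans[of 0 "1 / S"])
qed

lemma opt_mono: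
  assumes "proper_rows (rs @ rs')"
  shows "opt rs \<le> opt (rs @ rs')"
  unfolding opt_def[of "rs @ rs'"]
proof (rule cInf_greatest)
  show "{t. \<exists>x. covers (rs @ rs') x \<and> cost_le t x} \<noteq> {}"
    using exists_covers[OF assms] by blast
  show "opt rs \<le> t" if "t \<in> {t. \<exists>x. covers (rs @ rs') x \<and> cost_le t x}" for t
    using that opt_le[of rs] by (fastforce simp: covers_def)
qed

lemma guess_bounds:
  assumes "proper_rows rs" "rs \<noteq> []"
  shows "opt rs < guess rs" "guess rs \<le> 2 * opt rs"
proof -
  have pos: "0 < opt rs" using opt_pos[OF assms] .
  have "log 2 (opt rs) < real_of_int (level rs)" unfolding level_def by linarith
  then show "opt rs < guess rs" using pos by (simp add: guess_def log_less_iff)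
  have "real_of_int (level rs) \<le> log 2 (opt rs) + 1" unfolding level_def by linarith
  then have "guess rs \<le> 2 powr (log 2 (opt rs) + 1)" by (simp add: guess_def)
  then show "guess rs \<le> 2 * opt rs" using pos by (simp add: powr_add)
qed

lemma exists_within_guess:
  assumes "proper_rows rs" "rs \<noteq> []"
  shows "\<exists>z. covers rs z \<and> cost_le (guess rs) z"
proof -
  have "\<exists>t\<in>{t. \<exists>x. covers rs x \<and> cost_le t x}. t < guess rs"
    using guess_bounds(1)[OF assms] exists_covers[OF assms(1)] unfolding opt_def
    by (intro cInf_lessD) auto
  then show ?thesis using cost_le_mono by force
qed

lemma level_mono:
  assumes "proper_rows (rs @ rs')" "rs \<noteq> []"
  shows "level rs \<le> level (rs @ rs')"
proof -
  have "proper_rows rs" using assms(1) by (auto simp: proper_rows_def nonneg_rows_def)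
  then have "log 2 (opt rs) \<le> log 2 (opt (rs @ rs'))"
    using opt_pos assms opt_mono[OF assms(1)] by (auto intro!: log_mono)
  then show ?thesis unfolding level_def by (auto intro: floor_mono)
qed

end

section \<open>Combining all guesses into one monotone algorithm\<close>

primrec running_max :: "('a list \<Rightarrow> 'i \<Rightarrow> real) \<Rightarrow> 'a list \<Rightarrow> 'i \<Rightarrow> real" where
  "running_max F [] = (\<lambda>_. 0)"
| "running_max F (a # as) = (\<lambda>i. max (running_max F as i) (F (rev (a # as)) i))"

context mixed_covering
begin

text \<open>The factor 4 arises because the answer lies below the sum of two vectors of cost at most
  \<open>ratio * guess rs\<close> each, and for nonempty \<open>rs\<close> the guess is at most
  twice the cost of any cover.\<close>

theorem competitive_algorithm:
  "\<exists>A. (\<forall>rs i. 0 \<le> A rs i) \<and> (\<forall>rs a i. A rs i \<le> A (rs @ [a]) i) \<and>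
     (\<forall>rs a. proper_rows (rs @ [a]) \<longrightarrow> 1 \<le> dot a (A (rs @ [a]))) \<and>
     (\<forall>rs y t. proper_rows rs \<longrightarrow> covers rs y \<longrightarrow> cost_le t y \<longrightarrow> cost_le (4 * ratio * t) (A rs))"
proof -
  define good where "good t B \<longleftrightarrow> (\<forall>rs z. nonneg_rows rs \<longrightarrow> covers rs z \<longrightarrow> cost_le t z \<longrightarrow>
     (\<forall>i\<in>I. 0 \<le> B rs i) \<and> cost_le (ratio * t) (B rs) \<and>
     (\<forall>rs' a. rs = rs' @ [a] \<longrightarrow> (\<forall>i\<in>I. B rs' i \<le> B rs i) \<and> 1 \<le> dot a (B rs)))"
    for t and B :: "('i \<Rightarrow> real) list \<Rightarrow> 'i \<Rightarrow> real"
  have "\<forall>t. \<exists>B. 0 < t \<longrightarrow> good t B"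
    using guess_algorithm unfolding good_def by blast
  then obtain B where B: "\<And>t. 0 < t \<Longrightarrow> good t (B t)"
    by metis
  \<comment> \<open>The algorithm for the current guess is replayed on all rows seen so far, so a
    raised guess starts afresh from the first row.\<close>
  define F where "F rs = B (guess rs) rs" for rs
  \<comment> \<open>After reversal the list without its last row is the tail. Thus
    \<open>A rs\<close> is the maximum of 0 and the values of \<open>F\<close> on all nonempty
    prefixes of \<open>rs\<close>.\<close>
  define A where "A rs = running_max F (rev rs)" for rs
  have A_Nil: "A [] = (\<lambda>_. 0)" by (simp add: A_def)
  have A_snoc: "A (rs @ [a]) i = max (A rs i) (F (rs @ [a]) i)" for rs a i
    by (simp add: A_def)
  have guess_pos: "0 < guess rs" for rs by (simp add: guess_def)
  have F: "(\<forall>i\<in>I. 0 \<le> F rs i) \<and> cost_le (ratio * guess rs) (F rs) \<and>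
     (\<forall>rs' a. rs = rs' @ [a] \<longrightarrow>
       (\<forall>i\<in>I. B (guess rs) rs' i \<le> F rs i) \<and> 1 \<le> dot a (F rs))"
    if "proper_rows rs" "rs \<noteq> []" for rs
    using exists_within_guess[OF that] B[OF guess_pos[of rs]] that(1)
    unfolding F_def proper_rows_def good_def by blast
  \<comment> \<open>\<open>R\<close> collects what is left from smaller guesses. Its bound
    \<open>ratio * guess rs\<close> is the geometric sum of their costs in inductive form.\<close>
  have split: "\<exists>R. (\<forall>i\<in>I. 0 \<le> R i \<and> A rs i \<le> F rs i + R i) \<and> cost_le (ratio * guess rs) R"
    if "proper_rows rs" "rs \<noteq> []" for rs
    using that
  proof (induction rs rule: rev_induct)
    case Nil
    then show ?case by simp
  next
    case (snoc a rs)
    have pos: "\<forall>i\<in>I. 0 \<le> F (rs @ [a]) i" using F[OF snoc.prems] by blast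
    have proper: "proper_rows rs"
      using snoc.prems by (auto simp: proper_rows_def nonneg_rows_def)
    show ?case
    proof (cases "rs = []")
      case True
      then have "\<forall>i\<in>I. 0 \<le> (0::real) \<and> A (rs @ [a]) i \<le> F (rs @ [a]) i + 0"
        using pos A_snoc[of "[]" a] by (auto simp: A_Nil)
      moreover have "cost_le (ratio * guess (rs @ [a])) (\<lambda>_. 0)"
        using ratio_nonneg guess_pos[of "rs @ [a]"] by (simp add: cost_le_def)
      ultimately show ?thesis by (intro exI[of _ "\<lambda>_. 0"]) simp
    next
      case False
      obtain R where R: "\<forall>i\<in>I. 0 \<le> R i \<and> A rs i \<le> F rs i + R i" "cost_le (ratio * guess rs) R"
        using snoc.IH[OF proper False] by blast
      have Frs: "\<forall>i\<in>I. 0 \<le> F rs i" "cost_le (ratio * guess rs) (F rs)"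
        using F[OF proper False] by blast+
      consider "level (rs @ [a]) = level rs" | "level rs + 1 \<le> level (rs @ [a])"
        using level_mono[OF snoc.prems(1) False] by linarith
      then show ?thesis
      proof cases
        \<comment> \<open>Same guess, same algorithm: the new answer dominates the old one and
          \<open>R\<close> is kept.\<close>
        case 1
        then have eq: "guess (rs @ [a]) = guess rs" by (simp add: guess_def)
        then have "\<forall>i\<in>I. F rs i \<le> F (rs @ [a]) i"
          using F[OF snoc.prems] by (auto simp: F_def)
        then have "\<forall>i\<in>I. 0 \<le> R i \<and> A (rs @ [a]) i \<le> F (rs @ [a]) i + R i"
          using R(1) by (fastforce simp: A_snoc)
        then show ?thesis using R(2) eq by (intro exI[of _ R]) simp
      next
        \<comment> \<open>The guess at least doubles, so the old answer and \<open>R\<close>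
          together cost at most \<open>ratio\<close> times the new guess and form the new
          remainder.\<close>
        case 2
        have "real_of_int (level rs) + 1 \<le> real_of_int (level (rs @ [a]))"
          using 2 by linarith
        then have "2 powr (real_of_int (level rs) + 1) \<le> guess (rs @ [a])"
          unfolding guess_def by (intro powr_mono) auto
        then have le: "2 * guess rs \<le> guess (rs @ [a])"
          by (simp add: guess_def powr_add)
        define R' where "R' i = F rs i + R i" for i
        have "\<forall>i\<in>I. 0 \<le> R' i \<and> A (rs @ [a]) i \<le> F (rs @ [a]) i + R' i"
          using R(1) Frs(1) pos by (fastforce simp: A_snoc R'_def)
        moreover have "cost_le (ratio * guess (rs @ [a])) R'"
        proof (rule cost_le_mono)
          show "cost_le (ratio * guess rs + ratio * guess rs) R'"
            unfolding R'_def using cost_le_add[OF Frs(2) R(2)] .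
          show "ratio * guess rs + ratio * guess rs \<le> ratio * guess (rs @ [a])"
            using mult_left_mono[OF le ratio_nonneg] by simp
        qed simp
        ultimately show ?thesis by blast
      qed
    qed
  qed
  have "0 \<le> A rs i" for rs i
    by (induction rs rule: rev_induct) (auto simp: A_Nil A_snoc le_max_iff_disj)
  moreover have "1 \<le> dot a (A (rs @ [a]))" if "proper_rows (rs @ [a])" for rs a
  proof -
    have "1 \<le> dot a (F (rs @ [a]))" using F[OF that] by blast
    also have "\<dots> \<le> dot a (A (rs @ [a]))"
      using that by (intro sum_mono mult_left_mono)
        (auto simp: A_snoc proper_rows_def nonneg_rows_def)
    finally show ?thesis .
  qed
  moreover have "cost_le (4 * ratio * t) (A rs)"
    if rs: "proper_rows rs" "covers rs y" "cost_le t y" for rs y t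
  proof (cases "rs = []")
    case True
    then show ?thesis
      using cost_nonneg[OF rs(2,3)] ratio_nonneg by (simp add: A_Nil cost_le_def)
  next
    case False
    obtain R where R: "\<forall>i\<in>I. 0 \<le> R i \<and> A rs i \<le> F rs i + R i" "cost_le (ratio * guess rs) R"
      using split[OF rs(1) False] by blast
    have "guess rs \<le> 2 * t"
      using guess_bounds(2)[OF rs(1) False] opt_le[OF rs(2,3)] by linarith
    show ?thesis
    proof (rule cost_le_mono)
      show "cost_le (ratio * guess rs + ratio * guess rs) (\<lambda>i. F rs i + R i)"
        using F[OF rs(1) False] R(2) by (intro cost_le_add) auto
      show "ratio * guess rs + ratio * guess rs \<le> 4 * ratio * t"
        using mult_left_mono[OF \<open>guess rs \<le> 2 * t\<close> ratio_nonneg] by (simp add: mult_ac)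
    qed (use R(1) in simp)
  qed
  ultimately show ?thesis
    by (intro exI[of _ A]) (simp add: A_snoc)
qed

text \<open>768 is 4 * 16 * 3 * 4: as \<open>d\<close> is at least 2, \<open>ln (4 * d)\<close> is
  at most \<open>3 * ln d\<close>, and \<open>2 * exp 1 < 8\<close> likewise gives the factor 4 for
  \<open>card K\<close>.\<close>

lemma ratio_le:
  assumes "2 \<le> card K"
  shows "4 * ratio \<le> 768 * ln (real (card K)) * ln (real d)"
proof -
  have ln_le: "ln (2 ^ m * real p) \<le> real (Suc m) * ln (real p)" if "2 \<le> p" for m p
  proof -
    have "ln (2 ^ m * real p) \<le> ln (real p ^ m * real p)"
      using that by (intro ln_mono mult_right_mono power_mono) auto
    also have "\<dots> = real (Suc m) * ln (real p)"
      using that ln_realpow[of "real p" "Suc m"] by (simp add: mult_ac)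
    finally show ?thesis .
  qed
  have "L \<le> 3 * ln (real d)" using ln_le[OF d_ge_2, of 2] by (simp add: L_def)
  moreover have "ln (2 * exp 1 * real (card K)) \<le> 4 * ln (real (card K))"
  proof -
    have "2 * exp 1 * real (card K) \<le> 2 ^ 3 * real (card K)"
      using exp_le by (intro mult_right_mono) auto
    then have "ln (2 * exp 1 * real (card K)) \<le> ln (2 ^ 3 * real (card K))"
      using assms by (intro ln_mono) auto
    then show ?thesis using ln_le[OF assms, of 3] by simp
  qed
  moreover have "0 \<le> ln (real (card K))" "0 \<le> L" using assms L_ge_1 by auto
  ultimately have "L * ln (2 * exp 1 * real (card K)) \<le> (3 * ln (real d)) * (4 * ln (real (card K)))"
    using d_ge_2 by (intro order_trans[OF mult_left_mono mult_right_mono]) auto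
  then show ?thesis by (simp add: ratio_def)
qed

end

section \<open>Transfer to vectors, with free coordinates\<close>

lemma nonneg_vecs_iff: "x \<in> nonneg_vecs n \<longleftrightarrow> dim_vec x = n \<and> (\<forall>i<n. 0 \<le> x $ i)"
  unfolding nonneg_vecs_def carrier_vec_def mem_Collect_eq less_eq_vec_def index_zero_vec(2)
  by (metis index_zero_vec(1))

theorem mainTheorem5:
  shows "\<exists>c::real. c > 0 \<and>
    (\<forall>(n::nat) (l::nat) (d::nat) (cs :: nat \<Rightarrow> real vec).
       l \<ge> 2 \<longrightarrow> d \<ge> 2 \<longrightarrow>
       (\<forall>k\<in>{1..l}. cs k \<in> nonneg_vecs n \<and> num_nonzero (cs k) \<le> d) \<longrightarrow>
       (\<exists>A. online_covering_algorithm n A \<and>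
            competitive n (max_cost l cs) (c * ln (real l) * ln (real d)) A))"
proof (intro exI[of _ 768] conjI allI impI)
  fix n l d :: nat and cs :: "nat \<Rightarrow> real vec"
  assume l: "l \<ge> 2" and d: "d \<ge> 2"
    and cs: "\<forall>k\<in>{1..l}. cs k \<in> nonneg_vecs n \<and> num_nonzero (cs k) \<le> d"
  \<comment> \<open>Coordinates outside \<open>I\<close> have price 0 in every cost and can be
    raised freely; those inside satisfy \<open>c_pos\<close>.\<close>
  define I where "I = {i \<in> {0..<n}. \<exists>k\<in>{1..l}. 0 < cs k $ i}"
  have I_sub: "I \<subseteq> {0..<n}" by (auto simp: I_def)
  have free: "cs k $ i = 0" if "k \<in> {1..l}" "i \<in> {0..<n} - I" for k i
  proof -
    have "\<not> 0 < cs k $ i" using that unfolding I_def by blast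
    moreover have "0 \<le> cs k $ i" using cs that nonneg_vecs_iff[of "cs k" n] by auto
    ultimately show ?thesis by simp
  qed
  interpret mixed_covering I "{1..l}" "\<lambda>k i. cs k $ i" d
  proof
    fix k assume k: "k \<in> {1..l}"
    have "card {i \<in> I. cs k $ i \<noteq> 0} \<le> num_nonzero (cs k)"
      unfolding num_nonzero_def using cs k
      by (intro card_mono) (auto simp: I_def nonneg_vecs_iff)
    then show "card {i \<in> I. cs k $ i \<noteq> 0} \<le> d" using cs k by fastforce
  qed (use l d cs in \<open>auto simp: I_def nonneg_vecs_iff\<close>)
  obtain A where A: "(\<forall>rs i. 0 \<le> A rs i) \<and> (\<forall>rs a i. A rs i \<le> A (rs @ [a]) i) \<and>
     (\<forall>rs a. proper_rows (rs @ [a]) \<longrightarrow> 1 \<le> dot a (A (rs @ [a]))) \<and>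
     (\<forall>rs y t. proper_rows rs \<longrightarrow> covers rs y \<longrightarrow> cost_le t y \<longrightarrow> cost_le (4 * ratio * t) (A rs))"
    using competitive_algorithm by (rule exE)
  then have A_nonneg: "0 \<le> A rs i" and A_mono: "A rs i \<le> A (rs @ [a]) i"
    and A_covers: "proper_rows (rs @ [a]) \<Longrightarrow> 1 \<le> dot a (A (rs @ [a]))"
    and A_cost: "proper_rows rs \<Longrightarrow> covers rs y \<Longrightarrow> cost_le t y \<Longrightarrow> cost_le (4 * ratio * t) (A rs)"
    for rs a i y t
    by blast+
  \<comment> \<open>Any other row has a nonzero free coordinate and is covered through it at no
    cost, so only the \<open>costly\<close> rows are passed on to \<open>A\<close>.\<close>
  define costly where "costly a \<longleftrightarrow> (\<forall>i\<in>{0..<n} - I. a $ i = 0)" for a :: "real vec"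
  define rows where "rows rs = map (\<lambda>a i. a $ i) (filter costly rs)" for rs :: "real vec list"
  \<comment> \<open>Summing over all rows makes the free coordinates monotone. With
    \<open>1 / 0 = 0\<close>, a row with a positive entry at \<open>i\<close> adds exactly what
    covers it there.\<close>
  define cheap where "cheap rs i = (\<Sum>a\<leftarrow>rs. 1 / \<bar>a $ i\<bar>)" for rs :: "real vec list" and i
  define X where "X rs = vec n (\<lambda>i. if i \<in> I then A (rows rs) i else cheap rs i)" for rs
  have dim_X: "dim_vec (X rs) = n" for rs by (simp add: X_def)
  have cheap_nonneg: "0 \<le> cheap rs i" for rs i
    unfolding cheap_def by (intro sum_list_nonneg) auto
  have X_nonneg: "X rs \<in> nonneg_vecs n" for rs
    using A_nonneg cheap_nonneg by (simp add: nonneg_vecs_iff X_def)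
  have X_mono: "X rs \<le> X (rs @ [a])" for rs a
    using A_mono by (auto simp: less_eq_vec_def X_def rows_def cheap_def)
  have prod_eq: "u \<bullet> x = dot (($) u) (($) x)"
    if "dim_vec x = n" "\<forall>i\<in>{0..<n} - I. u $ i = 0" for u x :: "real vec"
    unfolding scalar_prod_def that(1) using that(2) I_sub by (intro sum.mono_neutral_right) auto
  have dot_X: "dot u (($) (X rs)) = dot u (A (rows rs))" for u rs
    using I_sub by (intro sum.cong refl) (auto simp: X_def)
  have proper: "proper_rows (rows rs)" if "covering_instance n rs" for rs
    unfolding proper_rows_def nonneg_rows_def
  proof (intro conjI ballI)
    fix a assume "a \<in> set (rows rs)"
    then obtain v where v: "v \<in> set rs" "costly v" "a = ($) v" by (auto simp: rows_def)
    have nn: "v \<in> nonneg_vecs n" "v \<noteq> 0\<^sub>v n" using that v by (auto simp: covering_instance_def)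
    show "0 \<le> a i" if "i \<in> I" for i
      using nn(1) v(3) that by (auto simp: nonneg_vecs_iff I_def)
    have "\<exists>i<n. v $ i \<noteq> 0"
      using nn by (auto simp: nonneg_vecs_iff intro!: eq_vecI)
    then show "\<exists>i\<in>I. a i \<noteq> 0" using v(2,3) by (auto simp: costly_def)
  qed
  have X_covers: "1 \<le> a \<bullet> X (rs @ [a])" if inst: "covering_instance n (rs @ [a])" for rs a
  proof (cases "costly a")
    case True
    then show ?thesis
      using A_covers[of "rows rs" "($) a"] proper[OF inst]
      by (simp add: prod_eq dim_X dot_X costly_def) (simp add: rows_def costly_def)
  next
    case False
    then obtain i where i: "i \<in> {0..<n} - I" "a $ i \<noteq> 0" by (auto simp: costly_def)
    have a: "\<forall>i<n. 0 \<le> a $ i" using inst by (auto simp: covering_instance_def nonneg_vecs_iff)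
    have ai: "0 < a $ i" using a i by force
    have "1 / \<bar>a $ i\<bar> \<le> cheap (rs @ [a]) i"
      using cheap_nonneg[of rs i] by (simp add: cheap_def)
    then have "1 \<le> a $ i * X (rs @ [a]) $ i"
      using i ai by (simp add: X_def field_simps)
    also have "\<dots> \<le> a \<bullet> X (rs @ [a])"
      unfolding scalar_prod_def dim_X using i a X_nonneg
      by (intro member_le_sum) (auto simp: nonneg_vecs_iff)
    finally show ?thesis .
  qed
  have fin_cost: "max_cost l cs x \<le> t \<longleftrightarrow> cost_le t (($) x)" if "dim_vec x = n" for x t
    unfolding max_cost_def cost_le_def using l that free by (subst Max_le_iff) (auto simp: prod_eq)
  \<comment> \<open>The infimum in \<open>opt_cost\<close> must be seen to range over a nonempty
    set. The algorithm's own vector is feasible, as earlier rows stay covered when coordinates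
    grow.\<close>
  have X_feasible: "X rs \<in> feasible n rs" if "covering_instance n rs" for rs
    using that
  proof (induction rs rule: rev_induct)
    case Nil
    show ?case using X_nonneg by (simp add: feasible_def)
  next
    case (snoc a rs)
    have "1 \<le> v \<bullet> X (rs @ [a])" if v: "v \<in> set rs" for v
    proof -
      have "1 \<le> v \<bullet> X rs"
        using snoc v by (auto simp: feasible_def covering_instance_def)
      also have "\<dots> \<le> v \<bullet> X (rs @ [a])"
        unfolding scalar_prod_def dim_X using X_mono[of rs a] snoc.prems v
        by (intro sum_mono mult_left_mono)
          (auto simp: less_eq_vec_def dim_X covering_instance_def nonneg_vecs_iff)
      finally show ?thesis .
    qed
    then show ?case using X_nonneg X_covers[OF snoc.prems] by (auto simp: feasible_def)
  qed
  have "max_cost l cs (X rs) \<le> 768 * ln (real l) * ln (real d) * opt_cost n (max_cost l cs) rs"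
    if inst: "covering_instance n rs" for rs
  proof -
    have C: "0 < 768 * ln (real l) * ln (real d)" using l d by simp
    \<comment> \<open>With the factor moved to the left, the claim is a lower bound for every
      feasible cost, hence for their infimum.\<close>
    have "max_cost l cs (X rs) / (768 * ln (real l) * ln (real d)) \<le> max_cost l cs x"
      if x: "x \<in> feasible n rs" for x
    proof -
      have dim_x: "dim_vec x = n" and x_nonneg: "\<forall>i<n. 0 \<le> x $ i"
        using x by (auto simp: feasible_def nonneg_vecs_iff)
      have cov: "covers (rows rs) (($) x)"
        unfolding covers_def
      proof (intro conjI ballI)
        show "0 \<le> x $ i" if "i \<in> I" for i
          using x_nonneg I_sub that by (meson atLeastLessThan_iff subsetD)
        fix a assume "a \<in> set (rows rs)"
        then obtain v where v: "v \<in> set rs" "costly v" "a = ($) v" by (auto simp: rows_def)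
        then have "v \<bullet> x = dot a (($) x)" using dim_x by (simp add: prod_eq costly_def)
        then show "1 \<le> dot a (($) x)" using x v(1) unfolding feasible_def by force
      qed
      have le: "cost_le (max_cost l cs x) (($) x)" using fin_cost[OF dim_x] by blast
      have "cost_le (4 * ratio * max_cost l cs x) (A (rows rs))"
        using A_cost[OF proper[OF inst] cov le] .
      then have "max_cost l cs (X rs) \<le> 4 * ratio * max_cost l cs x"
        unfolding fin_cost[OF dim_X] cost_le_def dot_X .
      also have "\<dots> \<le> 768 * ln (real l) * ln (real d) * max_cost l cs x"
        using ratio_le l cost_nonneg[OF cov le] by (intro mult_right_mono) auto
      finally show ?thesis using C by (simp add: pos_divide_le_eq mult_ac)
    qed
    then have "max_cost l cs (X rs) / (768 * ln (real l) * ln (real d))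
        \<le> opt_cost n (max_cost l cs) rs"
      unfolding opt_cost_def using X_feasible[OF inst] by (intro cInf_greatest) auto
    then show ?thesis using C by (simp add: pos_divide_le_eq mult_ac)
  qed
  then show "\<exists>A. online_covering_algorithm n A \<and>
      competitive n (max_cost l cs) (768 * ln (real l) * ln (real d)) A"
    using X_nonneg X_mono X_covers
    by (intro exI[of _ X]) (auto simp: online_covering_algorithm_def competitive_def)
qed simp

end
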